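(* Let $R$ be a strict (commutative) semiring without zero divisors. Then the polynomial algebra $R[T]$ does not satisfy the unique factorization property.
   Context: A (commutative) semiring (with $0$ and $1$) is a set $R$ with two constants $0$ and $1$ and two binary operations $+$ and $\cdot$ such that both $(R,+,0)$ and $(R,\cdot,1)$ are commutative monoids and such that $0\cdot a=0$ and $a(b+c)=ab+ac$ for all $a,b,c\in R$. A semiring $R$ is strict if $a+b=0$ implies $a=b=0$ for all $a,b\in R$. It is without zero divisors if $ab=0$ implies $a=0$ or $b=0$ for all $a,b\in R$. An element of $R$ is a unit if it has an inverse element in the multiplicative monoid of $R$; the set of all units of $R$ is denoted $R^\times$. A non-zero non-unit element of a semiring is irreducible if it is not a product of two non-units. A semiring admits (satisfies) the unique factorization property if it is without zero divisors and every non-zero non-unit element has a unique factorization into irreducible elements, up to permutations and multiplication by units. The polynomial algebra over $R$ is the semiring $R[T]$ of formal sums $\sum_{i\in\mathbb{N}} a_iT^i$ with $a_i\in R$, where there is $n$ such that $a_i=0$ for all $i>n$, together with the usual addition and multiplication of polynomials.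
   Formalization: The semiring R is assumed to be non-zero (0 ≠ 1); for the zero semiring, which the stated axioms allow, R[T] = {0} satisfies the unique factorization property vacuously and the claim fails. *)

theory Defs
  imports "HOL-Library.Multiset" "HOL-Computational_Algebra.Polynomial"
    "HOL-Computational_Algebra.Factorial_Ring"
begin

text \<open>
  Semirings are types of class \<^class>\<open>comm_semiring_1\<close>, which includes \<open>0 \<noteq> 1\<close>.
  Units are the elements \<open>u\<close> with \<open>u dvd 1\<close>; \<open>irreducible\<close> is the library predicate.
\<close>

definition strict_semiring :: "'a::comm_semiring_1 itself \<Rightarrow> bool" where
  "strict_semiring _ \<longleftrightarrow> (\<forall>a b::'a. a + b = 0 \<longrightarrow> a = 0 \<and> b = 0)"

definition irreducible_factorization :: "'a::comm_semiring_1 \<Rightarrow> 'a multiset \<Rightarrow> bool" where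
  "irreducible_factorization x A \<longleftrightarrow> (\<forall>p\<in>#A. irreducible p) \<and> prod_mset A = x"

text \<open>
  In a general semiring mutual divisibility need not give a unit factor, so the unit is explicit.
\<close>

definition unit_multiple :: "'a::comm_semiring_1 \<Rightarrow> 'a \<Rightarrow> bool" where
  "unit_multiple p q \<longleftrightarrow> (\<exists>u. u dvd 1 \<and> q = u * p)"

text \<open>
  Multisets account for permutations of the factors, and \<open>rel_mset\<close> for a matching of the
  factors up to units. Since \<open>x\<close> is not a unit, the empty multiset never factors \<open>x\<close>.
\<close>

definition unique_factorization :: "'a::comm_semiring_1 itself \<Rightarrow> bool" where
  "unique_factorization _ \<longleftrightarrow>
     (\<forall>a b::'a. a * b = 0 \<longrightarrow> a = 0 \<or> b = 0) \<and>
     (\<forall>x::'a. x \<noteq> 0 \<and> \<not> x dvd 1 \<longrightarrow>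
        (\<exists>A. irreducible_factorization x A) \<and>
        (\<forall>A B. irreducible_factorization x A \<and> irreducible_factorization x B \<longrightarrow>
           rel_mset unit_multiple A B))"

end

theory Submission
  imports Defs
begin

text \<open>
  The polynomial \<open>1 + T + T\<^sup>2 + T\<^sup>3 + T\<^sup>4 + T\<^sup>5\<close> has the two factorizations
  \<open>(1 + T\<^sup>3) (1 + T + T\<^sup>2) = (1 + T) (1 + T\<^sup>2 + T\<^sup>4)\<close>, valid over every semiring. Over the integers
  the two refine to a common one through \<open>1 - T + T\<^sup>2\<close>, which divides both \<open>1 + T\<^sup>3\<close> and
  \<open>1 + T\<^sup>2 + T\<^sup>4\<close>. Strictness rules out such negative coefficients: over a strict semiring without
  zero divisors nothing cancels in a product, so the exponents that occur in \<open>f * g\<close> are exactly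
  the sums of an exponent of \<open>f\<close> and an exponent of \<open>g\<close> (\<open>coeff_mult_nonzero\<close>).
  Comparing exponents shows that \<open>1 + T\<^sup>3\<close> is irreducible (\<open>irreducible_one_plus_monom\<close>) and that
  it divides neither \<open>1 + T\<close> nor \<open>1 + T\<^sup>2 + T\<^sup>4\<close>: a multiple of it with non-zero constant term
  contains \<open>T\<^sup>3\<close> (\<open>coeff_nonzero_if_dvd\<close>).
  Unique factorization would make the irreducible \<open>1 + T\<^sup>3\<close> behave like a prime
  (\<open>unique_factorization_imp_dvd_factor\<close>), which it does not.

  The trinomial factors need not be irreducible: if \<open>1 + 1 = 1\<close>, then
  \<open>1 + T + T\<^sup>2 = (1 + T)\<^sup>2\<close> and \<open>1 + T\<^sup>2 + T\<^sup>4 = (1 + T\<^sup>2)\<^sup>2\<close>. This is why the argument shows that an irreducible element fails to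
  be prime, instead of comparing two explicit lists of irreducible factors.
\<close>

lemma unique_factorization_imp_dvd_factor:
  fixes p a b c :: "'a::comm_semiring_1"
  assumes uf: "unique_factorization TYPE('a)"
    and p: "irreducible p" and eq: "p * c = a * b"
    and a: "a \<noteq> 0" "\<not> a dvd 1" and b: "b \<noteq> 0" "\<not> b dvd 1" and c: "c \<noteq> 0" "\<not> c dvd 1"
  shows "p dvd a \<or> p dvd b"
proof -
  obtain A B C where A: "irreducible_factorization a A" and B: "irreducible_factorization b B"
    and C: "irreducible_factorization c C"
    using uf a b c unfolding unique_factorization_def by meson
  have "a * b \<noteq> 0"
    using uf a b unfolding unique_factorization_def by blast
  moreover have "\<not> a * b dvd 1"
    using a(2) dvd_mult_left by blast
  moreover have "irreducible_factorization (a * b) (add_mset p C)"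
    using C p eq by (auto simp: irreducible_factorization_def)
  moreover have "irreducible_factorization (a * b) (A + B)"
    using A B by (auto simp: irreducible_factorization_def)
  ultimately have "rel_mset unit_multiple (add_mset p C) (A + B)"
    using uf unfolding unique_factorization_def by blast
  then obtain q D where "A + B = add_mset q D" and pq: "unit_multiple p q"
    by (auto dest: msed_rel_invL)
  then have "q \<in># A \<or> q \<in># B"
    by (metis union_iff union_single_eq_member)
  moreover have "p dvd q"
    using pq by (auto simp: unit_multiple_def)
  ultimately show ?thesis
    using A B unfolding irreducible_factorization_def
    by (metis dvd_prod_mset dvd_trans)
qed

lemma strict_semiring_sum_eq_0D:
  fixes f :: "'b \<Rightarrow> 'a::comm_semiring_1"
  assumes strict: "strict_semiring TYPE('a)"
    and "finite A" and "sum f A = 0" and "x \<in> A"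
  shows "f x = 0"
  using assms(2-4)
proof (induction A)
  case (insert y A)
  then have "f y + sum f A = 0"
    by simp
  then have "f y = 0 \<and> sum f A = 0"
    using strict unfolding strict_semiring_def by blast
  then show ?case
    using insert by auto
qed simp

text \<open>
  A coefficient of a product is a sum of products of coefficients, and strictness prevents a
  non-zero summand from being cancelled by the others.
\<close>

lemma coeff_mult_nonzero:
  fixes f g :: "'a::{comm_semiring_1, semiring_no_zero_divisors} poly"
  assumes strict: "strict_semiring TYPE('a)"
    and "coeff f i \<noteq> 0" and "coeff g j \<noteq> 0"
  shows "coeff (f * g) (i + j) \<noteq> 0"
proof
  assume "coeff (f * g) (i + j) = 0"
  then have "(\<Sum>k\<le>i + j. coeff f k * coeff g (i + j - k)) = 0"
    by (simp add: coeff_mult)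
  then have "coeff f i * coeff g (i + j - i) = 0"
    by (rule strict_semiring_sum_eq_0D[OF strict, rotated]) auto
  then show False
    using assms by simp
qed

text \<open>
  A non-zero constant coefficient of a multiple of \<open>f\<close> forces that of the cofactor to be
  non-zero, so every exponent of \<open>f\<close> reappears in the multiple.
\<close>

lemma coeff_nonzero_if_dvd:
  fixes f h :: "'a::{comm_semiring_1, semiring_no_zero_divisors} poly"
  assumes strict: "strict_semiring TYPE('a)"
    and "f dvd h" and "coeff h 0 \<noteq> 0" and "coeff f i \<noteq> 0"
  shows "coeff h i \<noteq> 0"
proof -
  obtain g where h: "h = f * g"
    using \<open>f dvd h\<close> by (elim dvdE)
  then have "coeff g 0 \<noteq> 0"
    using \<open>coeff h 0 \<noteq> 0\<close> by (auto simp: coeff_mult)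
  then show ?thesis
    using coeff_mult_nonzero[OF strict \<open>coeff f i \<noteq> 0\<close>, of g 0] h by simp
qed

lemma not_unit_if_coeff_nonzero:
  fixes f :: "'a::{comm_semiring_1, semiring_no_zero_divisors} poly"
  assumes "strict_semiring TYPE('a)" and "coeff f i \<noteq> 0" and "i > 0"
  shows "\<not> f dvd 1"
  using coeff_nonzero_if_dvd[OF assms(1), of f 1 i] assms by auto

lemma coeff_one_plus_monom:
  "coeff (1 + monom 1 n :: 'a::comm_semiring_1 poly) k =
     (if k = 0 then 1 else 0) + (if k = n then 1 else 0)"
  by (auto simp: coeff_1)

text \<open>
  When \<open>g\<close> has an exponent \<open>n\<close>, any exponent \<open>i > 0\<close> of \<open>f\<close> would produce the exponent \<open>i + n\<close>,
  which exceeds those of \<open>1 + T\<^sup>n\<close>. Hence \<open>f\<close> is constant, and its value is invertible because the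
  constant coefficient of the product is \<open>1\<close>.
\<close>

lemma unit_if_cofactor_has_coeff:
  fixes f g :: "'a::{comm_semiring_1, semiring_no_zero_divisors} poly"
  assumes strict: "strict_semiring TYPE('a)"
    and eq: "f * g = 1 + monom 1 n" and n: "n > 0" and gn: "coeff g n \<noteq> 0"
  shows "f dvd 1"
proof -
  have "coeff f i = 0" if "i > 0" for i
    using coeff_mult_nonzero[OF strict _ gn, of f i] that n
    by (auto simp: eq coeff_one_plus_monom)
  then have f: "f = [:coeff f 0:]"
    by (intro poly_eqI) (auto simp: coeff_pCons split: nat.split)
  have "coeff (f * g) 0 = 1"
    using n by (simp add: eq)
  then have "1 = [:coeff f 0:] * [:coeff g 0:]"
    by (simp add: coeff_mult one_pCons mult.commute)
  then show ?thesis
    using f by (metis dvd_triv_left)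
qed

text \<open>
  If \<open>f * g = 1 + T\<^sup>n\<close>, then the exponent \<open>n\<close> splits as \<open>i + j\<close> with \<open>i\<close> an exponent of \<open>f\<close> and \<open>j\<close>
  one of \<open>g\<close>. Both factors also have the exponent \<open>0\<close>, so \<open>i\<close> itself is an exponent of
  \<open>1 + T\<^sup>n\<close>. Thus one factor takes the whole exponent \<open>n\<close> and the other one is a unit.
\<close>

lemma irreducible_one_plus_monom:
  assumes strict: "strict_semiring TYPE('a::{comm_semiring_1, semiring_no_zero_divisors})"
    and n: "n > 0"
  shows "irreducible (1 + monom 1 n :: 'a poly)"
proof (rule irreducibleI)
  have coeff_n: "coeff (1 + monom 1 n :: 'a poly) n \<noteq> 0"
    using n by (simp add: coeff_one_plus_monom)
  then show "1 + monom 1 n \<noteq> (0 :: 'a poly)"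
    by fastforce
  show "\<not> (1 + monom 1 n :: 'a poly) dvd 1"
    using not_unit_if_coeff_nonzero[OF strict coeff_n n] .
  fix f g :: "'a poly"
  assume eq: "1 + monom 1 n = f * g"
  have "coeff (f * g) n \<noteq> 0"
    using coeff_n by (simp add: eq)
  then obtain i where i: "i \<le> n" "coeff f i \<noteq> 0" "coeff g (n - i) \<noteq> 0"
    by (force simp: coeff_mult elim: sum.not_neutral_contains_not_neutral)
  have "coeff (f * g) 0 \<noteq> 0"
    using n by (simp add: eq[symmetric])
  then have "coeff (f * g) i \<noteq> 0"
    using coeff_nonzero_if_dvd[OF strict _ _ i(2), of "f * g"] by simp
  then have "i = 0 \<or> i = n"
    unfolding eq[symmetric] coeff_one_plus_monom by (auto split: if_splits)
  then show "f dvd 1 \<or> g dvd 1"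
  proof
    assume "i = 0"
    then have "f dvd 1"
      using unit_if_cofactor_has_coeff[OF strict eq[symmetric] n] i by simp
    then show ?thesis ..
  next
    assume "i = n"
    then have "g dvd 1"
      using unit_if_cofactor_has_coeff[OF strict, of g f n] eq n i by (simp add: mult.commute[of g f])
    then show ?thesis ..
  qed
qed

theorem theorem1:
  assumes "strict_semiring TYPE('a::{comm_semiring_1, semiring_no_zero_divisors})"
  shows "\<not> unique_factorization TYPE('a poly)"
proof
  assume uf: "unique_factorization TYPE('a poly)"
  define p a b c :: "'a poly" where "p = 1 + monom 1 3" and "a = 1 + monom 1 1"
    and "b = 1 + monom 1 2 + monom 1 4" and "c = 1 + monom 1 1 + monom 1 2"
  note defs = p_def a_def b_def c_def
  have eq: "p * c = a * b"
    by (simp add: defs algebra_simps mult_monom) (simp add: numeral_3_eq_3)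
  have irred: "irreducible p"
    unfolding p_def by (rule irreducible_one_plus_monom[OF assms]) simp
  have nonunit: "\<not> a dvd 1" "\<not> b dvd 1" "\<not> c dvd 1"
    using not_unit_if_coeff_nonzero[OF assms, of a 1] not_unit_if_coeff_nonzero[OF assms, of b 2]
      not_unit_if_coeff_nonzero[OF assms, of c 1]
    by (simp_all add: defs coeff_1)
  have coeff_0: "coeff a 0 = 1" "coeff b 0 = 1" "coeff c 0 = 1"
    by (simp_all add: defs)
  then have nonzero: "a \<noteq> 0" "b \<noteq> 0" "c \<noteq> 0"
    by auto
  have "p dvd a \<or> p dvd b"
    by (rule unique_factorization_imp_dvd_factor[OF uf irred eq]) (fact nonzero nonunit)+
  moreover have "coeff p 3 \<noteq> 0" "coeff a 3 = 0" "coeff b 3 = 0"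
    by (simp_all add: defs coeff_1)
  ultimately show False
    using coeff_nonzero_if_dvd[OF assms, of p _ 3] coeff_0 by auto
qed

end
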